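(* Let $\mathcal{M}_1$ be a general rotational surface of elliptic type in $\mathbb{E}^4_2$ with plane meridian curve $m$, i.e. the Lorentz surface $$z(u,v)=\left(f(u)\cos\alpha v,\ f(u)\sin\alpha v,\ g(u)\cos\beta v,\ g(u)\sin\beta v\right),\quad u\in J,\ v\in[0,2\pi),$$ where $\alpha,\beta$ are positive constants and $f,g$ are smooth functions on $J$ with $\alpha^2f^2-\beta^2g^2<0$ and $f'^2-g'^2>0$. Assume that $\mathcal{M}_1$ contains no open part of a plane. Then $\mathcal{M}_1$ is minimal if and only if the meridian curve $m$ (i.e. the pair $f,g$) is determined by one of the following: (i) $f=c\,g^{\pm\frac{\alpha}{\beta}}$ (for one of the two signs), where $c=const$, $c\neq0$, and $\alpha\neq\beta$; (ii) $\arcsin\left(\frac{\alpha f}{\sqrt{A}}\right)=\pm\frac{\alpha}{\beta}\arcsin\left(\frac{\beta g}{\sqrt{A}}\right)+C$ (for one of the two signs), where $C=const$, $A=const$, $A>0$, and $\alpha\neq\beta$; (iii) $(f+g)^2=a(f-g)^2+b$, where $a=const$, $a\neq0$, $b=const$, and $\alpha=\beta$.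
   Context: $\mathbb{E}^4_2$ is $\mathbb{R}^4$ with the metric $dx_1^2+dx_2^2-dx_3^2-dx_4^2$. $J\subset\mathbb{R}$ is an interval. The meridian curve $m$ is the plane curve $u\mapsto(f(u),0,g(u),0)$. A surface in $\mathbb{E}^4_2$ is Lorentz if its induced metric has signature $(1,1)$; here the first fundamental form is $E=f'^2-g'^2>0$, $F=0$, $G=\alpha^2f^2-\beta^2g^2<0$. With $\sigma$ the second fundamental form, the mean curvature vector field is $H=\frac12\operatorname{tr}\sigma=\frac12(\sigma(x,x)-\sigma(y,y))$ for an orthonormal tangent frame with $\langle x,x\rangle=1$, $\langle y,y\rangle=-1$. The surface is minimal if $H=0$ identically.
   Formalization: In (ii), arcsin(βg/√A) is read as a continuous branch of the multivalued arcsine along J, since with principal values "only if" fails where g'=0 (e.g. f=sin(αu)/α, g=cos(βu)/β near u=0); in (i), g^{±α/β} is read as |g|^{±α/β}. *)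

theory Defs
  imports "HOL-Analysis.Analysis"
begin

section \<open>The neutral space and smooth functions on an interval\<close>

definition neutral_inner :: "real^4 \<Rightarrow> real^4 \<Rightarrow> real" where
  "neutral_inner x y = x$1 * y$1 + x$2 * y$2 - x$3 * y$3 - x$4 * y$4"

text \<open>Derivatives are taken within the given interval, so they are one-sided at an endpoint
  that belongs to it; at interior points they are the usual ones.\<close>

definition smooth_fun_on :: "real set \<Rightarrow> (real \<Rightarrow> real) \<Rightarrow> bool" where
  "smooth_fun_on S h \<longleftrightarrow>
     (\<exists>D :: nat \<Rightarrow> real \<Rightarrow> real. D 0 = h \<and>
        (\<forall>k. \<forall>x\<in>S. (D k has_real_derivative D (Suc k) x) (at x within S)))"

definition deriv_on :: "real set \<Rightarrow> (real \<Rightarrow> real) \<Rightarrow> real \<Rightarrow> real" where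
  "deriv_on S h x = vector_derivative h (at x within S)"


section \<open>Parametrized surfaces\<close>

text \<open>A surface is given by a parametrization \<open>X\<close> on a parameter domain \<open>J \<times> K\<close>. A tangent
  vector at the parameter point \<open>(u, v)\<close> is represented by its coordinate pair \<open>(a, b)\<close>
  with respect to the coordinate fields, that is, it stands for \<open>a X\<^sub>u + b X\<^sub>v\<close>.\<close>

type_synonym surf = "real \<Rightarrow> real \<Rightarrow> real^4"

definition partial_u :: "real set \<Rightarrow> surf \<Rightarrow> surf" where
  "partial_u J X u v = vector_derivative (\<lambda>s. X s v) (at u within J)"

definition partial_v :: "real set \<Rightarrow> surf \<Rightarrow> surf" where
  "partial_v K X u v = vector_derivative (\<lambda>t. X u t) (at v within K)"

definition tangent_vec ::
    "real set \<Rightarrow> real set \<Rightarrow> surf \<Rightarrow> real \<Rightarrow> real \<Rightarrow> real \<times> real \<Rightarrow> real^4" where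
  "tangent_vec J K X u v p = fst p *\<^sub>R partial_u J X u v + snd p *\<^sub>R partial_v K X u v"

definition first_form ::
    "real set \<Rightarrow> real set \<Rightarrow> surf \<Rightarrow> real \<Rightarrow> real \<Rightarrow> real \<times> real \<Rightarrow> real \<times> real \<Rightarrow> real" where
  "first_form J K X u v p q =
     neutral_inner (tangent_vec J K X u v p) (tangent_vec J K X u v q)"

text \<open>The component orthogonal to the tangent plane; it is uniquely determined wherever the
  induced metric is nondegenerate, in particular on a Lorentz surface.\<close>

definition normal_part ::
    "real set \<Rightarrow> real set \<Rightarrow> surf \<Rightarrow> real \<Rightarrow> real \<Rightarrow> real^4 \<Rightarrow> real^4" where
  "normal_part J K X u v w =
     (THE n. w - n \<in> range (tangent_vec J K X u v) \<and>
             (\<forall>p. neutral_inner n (tangent_vec J K X u v p) = 0))"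

text \<open>The flat connection of the ambient space differentiates coordinatewise, so on coordinate
  fields the second fundamental form is the normal part of the second partial derivatives.\<close>

definition second_form ::
    "real set \<Rightarrow> real set \<Rightarrow> surf \<Rightarrow> real \<Rightarrow> real \<Rightarrow> real \<times> real \<Rightarrow> real \<times> real \<Rightarrow> real^4" where
  "second_form J K X u v p q =
       (fst p * fst q) *\<^sub>R normal_part J K X u v (partial_u J (partial_u J X) u v)
     + (fst p * snd q + snd p * fst q) *\<^sub>R
         normal_part J K X u v (partial_v K (partial_u J X) u v)
     + (snd p * snd q) *\<^sub>R normal_part J K X u v (partial_v K (partial_v K X) u v)"

definition orthonormal_frame ::
    "real set \<Rightarrow> real set \<Rightarrow> surf \<Rightarrow> real \<Rightarrow> real \<Rightarrow> real \<times> real \<Rightarrow> real \<times> real \<Rightarrow> bool" where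
  "orthonormal_frame J K X u v x y \<longleftrightarrow>
     first_form J K X u v x x = 1 \<and> first_form J K X u v y y = -1 \<and>
     first_form J K X u v x y = 0"

text \<open>On a Lorentz surface orthonormal frames exist and the expression below does not depend on
  the frame, since it is half the trace of the second fundamental form.\<close>

definition mean_curvature_vector ::
    "real set \<Rightarrow> real set \<Rightarrow> surf \<Rightarrow> real \<Rightarrow> real \<Rightarrow> real^4" where
  "mean_curvature_vector J K X u v =
     (THE h. \<exists>x y. orthonormal_frame J K X u v x y \<and>
        h = (1 / 2) *\<^sub>R (second_form J K X u v x x - second_form J K X u v y y))"

definition minimal_surface :: "real set \<Rightarrow> real set \<Rightarrow> surf \<Rightarrow> bool" where
  "minimal_surface J K X \<longleftrightarrow> (\<forall>u\<in>J. \<forall>v\<in>K. mean_curvature_vector J K X u v = 0)"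

definition contains_open_part_of_plane :: "real set \<Rightarrow> real set \<Rightarrow> surf \<Rightarrow> bool" where
  "contains_open_part_of_plane J K X \<longleftrightarrow>
     (\<exists>U P. openin (top_of_set (J \<times> K)) U \<and> U \<noteq> {} \<and>
        affine P \<and> aff_dim P = 2 \<and> (\<lambda>(u, v). X u v) ` U \<subseteq> P)"


section \<open>General rotational surfaces of elliptic type\<close>

definition rot_surface ::
    "real \<Rightarrow> real \<Rightarrow> (real \<Rightarrow> real) \<Rightarrow> (real \<Rightarrow> real) \<Rightarrow> surf" where
  "rot_surface \<alpha> \<beta> f g u v =
     vector [f u * cos (\<alpha> * v), f u * sin (\<alpha> * v), g u * cos (\<beta> * v), g u * sin (\<beta> * v)]"

lemma vector_4:
  "(vector [a, b, c, d] :: 'a::zero^4) $ 1 = a"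
  "(vector [a, b, c, d] :: 'a::zero^4) $ 2 = b"
  "(vector [a, b, c, d] :: 'a::zero^4) $ 3 = c"
  "(vector [a, b, c, d] :: 'a::zero^4) $ 4 = d"
  unfolding vector_def by simp_all

text \<open>A continuous branch, along \<open>J\<close>, of the (multivalued) arcsine of the function \<open>h\<close>.

  In the relation between \<open>arcsin (\<alpha> f / sqrt A)\<close> and \<open>arcsin (\<beta> g / sqrt A)\<close> the second
  arcsine has to be read in this sense. The principal value is not smooth where
  \<open>\<beta> g / sqrt A = \<plusminus>1\<close>, that is, where \<open>g' = 0\<close>, and this does happen on Lorentz minimal surfaces:
  for \<open>\<alpha> \<noteq> \<beta>\<close> let \<open>f u = sin (\<alpha> u) / \<alpha>\<close> and \<open>g u = cos (\<beta> u) / \<beta>\<close> for small \<open>\<bar>u\<bar>\<close>,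
  so that \<open>A = 1\<close>. Here the principal values are \<open>\<alpha> u\<close> and \<open>pi/2 - \<beta> \<bar>u\<bar>\<close>, and no single sign
  and constant relate them on both sides of \<open>0\<close>, whereas \<open>pi/2 + \<beta> u\<close> is a continuous
  branch for which the relation holds.
  The first arcsine can be the principal value, because \<open>\<bar>\<alpha> f\<bar> < \<bar>\<beta> g\<bar> \<le> sqrt A\<close>.\<close>

definition arcsin_branch_on :: "real set \<Rightarrow> (real \<Rightarrow> real) \<Rightarrow> (real \<Rightarrow> real) \<Rightarrow> bool" where
  "arcsin_branch_on J h \<theta> \<longleftrightarrow> continuous_on J \<theta> \<and> (\<forall>u\<in>J. sin (\<theta> u) = h u)"

lemma arcsin_branch_on_principal:
  assumes "continuous_on J h" and "\<And>u. u \<in> J \<Longrightarrow> \<bar>h u\<bar> \<le> 1"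
  shows "arcsin_branch_on J h (\<lambda>u. arcsin (h u))"
  unfolding arcsin_branch_on_def
  using assms by (auto intro!: continuous_on_arcsin simp: abs_le_iff)

end

theory Submission
  imports Defs
begin

text \<open>
  Write \<open>E = f'\<^sup>2 - g'\<^sup>2 > 0\<close> and \<open>G = \<alpha>\<^sup>2 f\<^sup>2 - \<beta>\<^sup>2 g\<^sup>2 < 0\<close>. The coordinates \<open>(u, v)\<close> are orthogonal, so
  \<open>H = 0\<close> says that \<open>z\<^sub>u\<^sub>u / E + z\<^sub>v\<^sub>v / G\<close> is tangent. In a frame rotating with \<open>v\<close>, its coefficients
  depend on \<open>u\<close> only, and the condition is the single differential equation
  \<open>G (f' g'' - g' f'') = E (\<beta>\<^sup>2 g f' - \<alpha>\<^sup>2 f g')\<close>  (\<open>mean_curvature_vector_eq_0_iff\<close>).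

  The equation has the first integral \<open>A = (\<beta>\<^sup>2 g\<^sup>2 f'\<^sup>2 - \<alpha>\<^sup>2 f\<^sup>2 g'\<^sup>2) / E\<close> (\<open>first_integral\<close>).
  The signs of \<open>E\<close> and \<open>G\<close> force \<open>A \<ge> \<beta>\<^sup>2 g\<^sup>2 > \<alpha>\<^sup>2 f\<^sup>2\<close>. Hence \<open>\<theta> = (\<beta> / \<alpha>) arcsin (\<alpha> f / \<surd>A)\<close> is
  differentiable; used as a parameter, it turns the equation into that of a
  harmonic oscillator for \<open>\<beta> g\<close>. So every solution satisfies \<open>\<beta> g = \<surd>A sin (\<theta> + \<delta>)\<close>, and
  conversely every such relation with \<open>A > 0\<close> gives a solution
  (\<open>minimal_imp_sine_relation\<close>, \<open>sine_relation_imp_minimal\<close>). This sine relation is the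
  pivot of the proof:

    \<^item> It is the arcsine relation with sign \<open>+\<close>, and the sign \<open>-\<close> reduces to it by replacing the
      branch by \<open>\<pi>\<close> minus the branch.

    \<^item> For \<open>\<alpha> = \<beta>\<close> it makes \<open>f + g\<close> and \<open>f - g\<close> multiples of the sine and the cosine of one angle,
      and \<open>sin\<^sup>2 + cos\<^sup>2 = 1\<close> is the quadratic relation. The converse is direct: two differentiations
      eliminate the constants \<open>a\<close> and \<open>b\<close>.

    \<^item> The power relation corresponds to \<open>A = 0\<close>. It implies \<open>\<beta> \<bar>g f'\<bar> = \<alpha> \<bar>f g'\<bar>\<close>, which
      contradicts \<open>\<beta> \<bar>g\<bar> > \<alpha> \<bar>f\<bar>\<close> and \<open>\<bar>f'\<bar> > \<bar>g'\<bar>\<close>.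
\<close>

section \<open>The mean curvature vector in orthogonal coordinates\<close>

lemma neutral_inner_simps:
  "neutral_inner (x + y) z = neutral_inner x z + neutral_inner y z"
  "neutral_inner (x - y) z = neutral_inner x z - neutral_inner y z"
  "neutral_inner (r *\<^sub>R x) z = r * neutral_inner x z"
  "neutral_inner z (x + y) = neutral_inner z x + neutral_inner z y"
  "neutral_inner z (r *\<^sub>R x) = r * neutral_inner z x"
  by (simp_all add: neutral_inner_def algebra_simps)

lemma neutral_inner_commute: "neutral_inner x y = neutral_inner y x"
  by (simp add: neutral_inner_def mult.commute)

text \<open>For orthogonal, non-null coordinate fields the Gram-Schmidt formula produces a vector with the
  two properties that characterize the normal part, and nondegeneracy makes it unique.\<close>

lemma normal_part_orthogonal:
  fixes X :: surf and J K :: "real set" and u v :: real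
  defines "Xu \<equiv> partial_u J X u v" and "Xv \<equiv> partial_v K X u v"
  assumes E: "neutral_inner Xu Xu \<noteq> 0" and F: "neutral_inner Xu Xv = 0"
    and G: "neutral_inner Xv Xv \<noteq> 0"
  shows "normal_part J K X u v w =
    w - (neutral_inner w Xu / neutral_inner Xu Xu) *\<^sub>R Xu
      - (neutral_inner w Xv / neutral_inner Xv Xv) *\<^sub>R Xv"
proof -
  have F': "neutral_inner Xv Xu = 0" using F by (simp add: neutral_inner_commute)
  have T: "tangent_vec J K X u v (a, b) = a *\<^sub>R Xu + b *\<^sub>R Xv" for a b
    by (simp add: tangent_vec_def Xu_def Xv_def)
  show ?thesis
    unfolding normal_part_def
  proof (rule the_equality, intro conjI allI)
    let ?n = "w - (neutral_inner w Xu / neutral_inner Xu Xu) *\<^sub>R Xu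
      - (neutral_inner w Xv / neutral_inner Xv Xv) *\<^sub>R Xv"
    have "w - ?n = tangent_vec J K X u v
        (neutral_inner w Xu / neutral_inner Xu Xu, neutral_inner w Xv / neutral_inner Xv Xv)"
      by (simp add: T)
    then show "w - ?n \<in> range (tangent_vec J K X u v)" by blast
    show "neutral_inner ?n (tangent_vec J K X u v p) = 0" for p
      using E F F' G by (cases p) (simp add: T neutral_inner_simps)
  next
    fix n
    assume n: "w - n \<in> range (tangent_vec J K X u v) \<and>
      (\<forall>p. neutral_inner n (tangent_vec J K X u v p) = 0)"
    then obtain a b where "w - n = tangent_vec J K X u v (a, b)" by auto
    then have w: "w = n + (a *\<^sub>R Xu + b *\<^sub>R Xv)" by (simp add: T algebra_simps)
    have "neutral_inner n Xu = 0" "neutral_inner n Xv = 0"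
      using n[THEN conjunct2, rule_format, of "(1, 0)"] n[THEN conjunct2, rule_format, of "(0, 1)"]
      by (simp_all add: T)
    then show "n = w - (neutral_inner w Xu / neutral_inner Xu Xu) *\<^sub>R Xu
      - (neutral_inner w Xv / neutral_inner Xv Xv) *\<^sub>R Xv"
      using E F F' G by (simp add: w neutral_inner_simps)
  qed
qed

text \<open>Why the trace does not depend on the frame: for any orthonormal frame \<open>x, y\<close> the tensor
  \<open>x \<otimes> x - y \<otimes> y\<close> is the inverse metric \<open>diag (1 / E, 1 / G)\<close>.\<close>

lemma orthonormal_frame_trace_coefficients:
  fixes E G :: real
  assumes "E > 0" "G < 0"
    and x: "E * x1\<^sup>2 + G * x2\<^sup>2 = 1" and y: "E * y1\<^sup>2 + G * y2\<^sup>2 = -1"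
    and xy: "E * x1 * y1 + G * x2 * y2 = 0"
  shows "x1\<^sup>2 - y1\<^sup>2 = 1 / E" "x1 * x2 = y1 * y2" "x2\<^sup>2 - y2\<^sup>2 = 1 / G"
proof -
  \<comment> \<open>In the coordinates scaled to unit length a frame is an element of \<open>O(1,1)\<close>. The orthogonality
    relation, squared, becomes linear in \<open>p\<close> and \<open>q\<close> because the product \<open>p q\<close> cancels.\<close>
  define p q where "p = E * x1\<^sup>2" and "q = E * y1\<^sup>2"
  have "(E * x1 * y1)\<^sup>2 = (G * x2 * y2)\<^sup>2"
    using xy by (simp add: add_eq_0_iff)
  then have "p * q = (G * x2\<^sup>2) * (G * y2\<^sup>2)"
    by (simp add: p_def q_def power2_eq_square algebra_simps)
  also have "G * x2\<^sup>2 = 1 - p" using x by (simp add: p_def)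
  also have "G * y2\<^sup>2 = - 1 - q" using y by (simp add: q_def)
  finally have pq: "p - q = 1" by (simp add: algebra_simps)
  then show 1: "x1\<^sup>2 - y1\<^sup>2 = 1 / E" using \<open>E > 0\<close> by (simp add: p_def q_def field_simps)
  have "G * x2\<^sup>2 - G * y2\<^sup>2 = 1" using x y pq by (simp add: p_def q_def)
  then show 3: "x2\<^sup>2 - y2\<^sup>2 = 1 / G" using \<open>G < 0\<close> by (simp add: field_simps)
  have "x1 \<noteq> 0" using x \<open>G < 0\<close> mult_nonpos_nonneg[of G "x2\<^sup>2"] by auto
  have "E * (x1 * (x1 * x2 - y1 * y2)) = x2 * (E * x1\<^sup>2 + G * y2\<^sup>2)"
    using xy by (simp add: power2_eq_square) algebra
  also have "E * x1\<^sup>2 + G * y2\<^sup>2 = 0"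
    using y pq by (simp add: p_def q_def)
  finally show "x1 * x2 = y1 * y2" using \<open>x1 \<noteq> 0\<close> \<open>E > 0\<close> by simp
qed

text \<open>The mixed term \<open>z\<^sub>u\<^sub>v\<close> drops out of the trace because the inverse metric is diagonal. The normal
  part is linear, so the vanishing of \<open>H\<close> becomes tangency of one vector.\<close>

lemma mean_curvature_vector_orthogonal:
  fixes X :: surf and J K :: "real set" and u v :: real
  defines "Xu \<equiv> partial_u J X u v" and "Xv \<equiv> partial_v K X u v"
  assumes E: "neutral_inner Xu Xu > 0" and F: "neutral_inner Xu Xv = 0"
    and G: "neutral_inner Xv Xv < 0"
  shows "mean_curvature_vector J K X u v = (1 / 2) *\<^sub>R normal_part J K X u v
    ((1 / neutral_inner Xu Xu) *\<^sub>R partial_u J (partial_u J X) u v +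
     (1 / neutral_inner Xv Xv) *\<^sub>R partial_v K (partial_v K X) u v)"
proof -
  let ?E = "neutral_inner Xu Xu" and ?G = "neutral_inner Xv Xv"
  let ?N = "normal_part J K X u v"
  let ?zuu = "partial_u J (partial_u J X) u v" and ?zvv = "partial_v K (partial_v K X) u v"
    and ?zuv = "partial_v K (partial_u J X) u v"
  have F': "neutral_inner Xv Xu = 0" using F by (simp add: neutral_inner_commute)
  have N: "?N w = w - (neutral_inner w Xu / ?E) *\<^sub>R Xu - (neutral_inner w Xv / ?G) *\<^sub>R Xv" for w
    using E F G normal_part_orthogonal[of J X u v K w] by (simp add: Xu_def Xv_def)
  have N_lin: "?N (r *\<^sub>R w + s *\<^sub>R w') = r *\<^sub>R ?N w + s *\<^sub>R ?N w'" for r s w w'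
    unfolding N by (simp add: neutral_inner_simps algebra_simps add_divide_distrib)
  have ff: "first_form J K X u v (a, b) (c, d) = ?E * a * c + ?G * b * d" for a b c d
    using F F' by (simp add: first_form_def tangent_vec_def neutral_inner_simps
        flip: Xu_def Xv_def)
  have trace: "second_form J K X u v x x - second_form J K X u v y y =
      ?N ((1 / ?E) *\<^sub>R ?zuu + (1 / ?G) *\<^sub>R ?zvv)"
    if "orthonormal_frame J K X u v x y" for x y
  proof -
    obtain x1 x2 y1 y2 where xy: "x = (x1, x2)" "y = (y1, y2)" by fastforce
    have c: "?E * x1\<^sup>2 + ?G * x2\<^sup>2 = 1" "?E * y1\<^sup>2 + ?G * y2\<^sup>2 = -1"
      "?E * x1 * y1 + ?G * x2 * y2 = 0"
      using that by (simp_all add: orthonormal_frame_def xy ff power2_eq_square mult.assoc)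
    note co = orthonormal_frame_trace_coefficients[OF E G c]
    have "second_form J K X u v x x - second_form J K X u v y y =
       (x1\<^sup>2 - y1\<^sup>2) *\<^sub>R ?N ?zuu + (2 * (x1 * x2 - y1 * y2)) *\<^sub>R ?N ?zuv
       + (x2\<^sup>2 - y2\<^sup>2) *\<^sub>R ?N ?zvv"
      by (simp add: second_form_def xy power2_eq_square algebra_simps)
    then show ?thesis by (simp add: co N_lin)
  qed
  have "orthonormal_frame J K X u v (1 / sqrt ?E, 0) (0, 1 / sqrt (- ?G))"
    using E G by (simp add: orthonormal_frame_def ff)
  then show ?thesis
    unfolding mean_curvature_vector_def
    by (intro the_equality) (metis trace)+
qed

section \<open>The rotating frame\<close>

text \<open>The pseudo-orthonormal frame \<open>(cos \<alpha>v, sin \<alpha>v, 0, 0)\<close>, \<open>(- sin \<alpha>v, cos \<alpha>v, 0, 0)\<close>,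
  \<open>(0, 0, cos \<beta>v, sin \<beta>v)\<close>, \<open>(0, 0, - sin \<beta>v, cos \<beta>v)\<close> rotates along the parallels of the surface;
  \<open>a, b, c, d\<close> are coefficients in this frame. The sum of multiples of axis vectors lets the
  derivative rules act on it directly.\<close>

definition rot_frame_vec :: "real \<Rightarrow> real \<Rightarrow> real \<Rightarrow> real \<Rightarrow> real \<Rightarrow> real \<Rightarrow> real \<Rightarrow> real^4" where
  "rot_frame_vec \<alpha> \<beta> v a b c d =
     (a * cos (\<alpha> * v) - b * sin (\<alpha> * v)) *\<^sub>R axis 1 1 +
     (a * sin (\<alpha> * v) + b * cos (\<alpha> * v)) *\<^sub>R axis 2 1 +
     (c * cos (\<beta> * v) - d * sin (\<beta> * v)) *\<^sub>R axis 3 1 +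
     (c * sin (\<beta> * v) + d * cos (\<beta> * v)) *\<^sub>R axis 4 1"

lemma rot_frame_vec_nth:
  "rot_frame_vec \<alpha> \<beta> v a b c d $ 1 = a * cos (\<alpha> * v) - b * sin (\<alpha> * v)"
  "rot_frame_vec \<alpha> \<beta> v a b c d $ 2 = a * sin (\<alpha> * v) + b * cos (\<alpha> * v)"
  "rot_frame_vec \<alpha> \<beta> v a b c d $ 3 = c * cos (\<beta> * v) - d * sin (\<beta> * v)"
  "rot_frame_vec \<alpha> \<beta> v a b c d $ 4 = c * sin (\<beta> * v) + d * cos (\<beta> * v)"
  by (simp_all add: rot_frame_vec_def axis_def)

lemma rot_surface_eq_frame_vec:
  "rot_surface \<alpha> \<beta> f g u v = rot_frame_vec \<alpha> \<beta> v (f u) 0 (g u) 0"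
  by (simp add: vec_eq_iff forall_4 rot_surface_def vector_4 rot_frame_vec_nth)

lemma rot_frame_vec_lin:
  "r *\<^sub>R rot_frame_vec \<alpha> \<beta> v a b c d = rot_frame_vec \<alpha> \<beta> v (r * a) (r * b) (r * c) (r * d)"
  "rot_frame_vec \<alpha> \<beta> v a b c d + rot_frame_vec \<alpha> \<beta> v a' b' c' d' =
     rot_frame_vec \<alpha> \<beta> v (a + a') (b + b') (c + c') (d + d')"
  "rot_frame_vec \<alpha> \<beta> v a b c d - rot_frame_vec \<alpha> \<beta> v a' b' c' d' =
     rot_frame_vec \<alpha> \<beta> v (a - a') (b - b') (c - c') (d - d')"
  by (simp_all add: vec_eq_iff forall_4 rot_frame_vec_nth algebra_simps)

lemma neutral_inner_rot_frame_vec: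
  "neutral_inner (rot_frame_vec \<alpha> \<beta> v a b c d) (rot_frame_vec \<alpha> \<beta> v a' b' c' d') =
     a * a' + b * b' - c * c' - d * d'"
proof -
  have rotate: "(a * C - b * S) * (a' * C - b' * S) + (a * S + b * C) * (a' * S + b' * C) =
    a * a' + b * b'" if "S\<^sup>2 + C\<^sup>2 = 1" for a b a' b' C S :: real
    using that by algebra
  show ?thesis
    using rotate[OF sin_cos_squared_add, of a "\<alpha> * v" b a' b']
      rotate[OF sin_cos_squared_add, of c "\<beta> * v" d c' d']
    by (simp add: neutral_inner_def rot_frame_vec_nth)
qed

lemma rot_frame_vec_eq_0_iff:
  "rot_frame_vec \<alpha> \<beta> v a b c d = 0 \<longleftrightarrow> a = 0 \<and> b = 0 \<and> c = 0 \<and> d = 0"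
proof
  let ?R = "rot_frame_vec \<alpha> \<beta> v"
  assume "?R a b c d = 0"
  then have "neutral_inner (?R a b c d) w = 0" for w by (simp add: neutral_inner_def)
  from this[of "?R 1 0 0 0"] this[of "?R 0 1 0 0"] this[of "?R 0 0 1 0"] this[of "?R 0 0 0 1"]
  show "a = 0 \<and> b = 0 \<and> c = 0 \<and> d = 0" by (simp add: neutral_inner_rot_frame_vec)
qed (simp add: rot_frame_vec_def)

lemma rot_frame_vec_has_vector_derivative_coeffs:
  assumes "(a has_real_derivative a') (at u within S)"
    and "(c has_real_derivative c') (at u within S)"
  shows "((\<lambda>s. rot_frame_vec \<alpha> \<beta> v (a s) 0 (c s) 0) has_vector_derivative
      rot_frame_vec \<alpha> \<beta> v a' 0 c' 0) (at u within S)"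
  unfolding rot_frame_vec_def
  using assms by (auto intro!: derivative_eq_intros simp: algebra_simps)

text \<open>Differentiation in \<open>v\<close> is a quarter turn in each of the two planes, scaled by \<open>\<alpha>\<close> and \<open>\<beta>\<close>.\<close>

lemma rot_frame_vec_has_vector_derivative_angle:
  "((\<lambda>t. rot_frame_vec \<alpha> \<beta> t a b c d) has_vector_derivative
      rot_frame_vec \<alpha> \<beta> v (- \<alpha> * b) (\<alpha> * a) (- \<beta> * d) (\<beta> * c)) (at v within S)"
  unfolding rot_frame_vec_def
  by (auto intro!: derivative_eq_intros simp: algebra_simps)

text \<open>Derivatives within a nondegenerate interval are unique, also at an endpoint.\<close>

lemma at_within_interval_neq_bot:
  fixes J :: "real set"
  assumes "is_interval J" "interior J \<noteq> {}" "x \<in> J"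
  shows "at x within J \<noteq> bot"
  using connected_imp_perfect[of J x] assms
  by (force simp: trivial_limit_within is_interval_connected_1 interior_singleton)

section \<open>The differential equation of a minimal meridian curve\<close>

text \<open>The functions \<open>f1, g1\<close> and \<open>f2, g2\<close> stand for the first and second derivatives within \<open>J\<close>.
  As parameters they give the computations below explicit names for these derivatives.\<close>

locale lorentz_meridian =
  fixes \<alpha> \<beta> :: real and J :: "real set" and f g f1 g1 f2 g2 :: "real \<Rightarrow> real"
  assumes interval: "is_interval J" "interior J \<noteq> {}"
    and pos: "\<alpha> > 0" "\<beta> > 0"
    and f_deriv: "\<And>u. u \<in> J \<Longrightarrow> (f has_real_derivative f1 u) (at u within J)"
    and g_deriv: "\<And>u. u \<in> J \<Longrightarrow> (g has_real_derivative g1 u) (at u within J)"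
    and f1_deriv: "\<And>u. u \<in> J \<Longrightarrow> (f1 has_real_derivative f2 u) (at u within J)"
    and g1_deriv: "\<And>u. u \<in> J \<Longrightarrow> (g1 has_real_derivative g2 u) (at u within J)"
    and G_neg: "\<And>u. u \<in> J \<Longrightarrow> \<alpha>\<^sup>2 * (f u)\<^sup>2 - \<beta>\<^sup>2 * (g u)\<^sup>2 < 0"
    and E_pos: "\<And>u. u \<in> J \<Longrightarrow> (f1 u)\<^sup>2 - (g1 u)\<^sup>2 > 0"
begin

text \<open>The polynomial form of the differential equation avoids dividing by \<open>E\<close>, \<open>G\<close> or \<open>f'\<close>.\<close>

definition minimal_eq :: "real \<Rightarrow> bool" where
  "minimal_eq u \<longleftrightarrow>
     (\<alpha>\<^sup>2 * (f u)\<^sup>2 - \<beta>\<^sup>2 * (g u)\<^sup>2) * (f1 u * g2 u - g1 u * f2 u) =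
     ((f1 u)\<^sup>2 - (g1 u)\<^sup>2) * (\<beta>\<^sup>2 * g u * f1 u - \<alpha>\<^sup>2 * f u * g1 u)"

lemma at_within_J: "u \<in> J \<Longrightarrow> at u within J \<noteq> bot"
  using interval by (rule at_within_interval_neq_bot)

lemma J_nonempty: "J \<noteq> {}"
  using interval by auto

lemma f1_nonzero: "u \<in> J \<Longrightarrow> f1 u \<noteq> 0"
  using E_pos[of u] by auto

text \<open>The vector \<open>z\<^sub>u\<^sub>u / E + z\<^sub>v\<^sub>v / G\<close> lies in the span of the first and third frame vectors, as does
  \<open>z\<^sub>u\<close>, while \<open>z\<^sub>v\<close> is orthogonal to this span. So it is tangent exactly if it is proportional
  to \<open>z\<^sub>u\<close>.\<close>

lemma mean_curvature_vector_eq_0_iff: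
  assumes u: "u \<in> J" and v: "v \<in> {0..<2 * pi}"
  shows "mean_curvature_vector J {0..<2 * pi} (rot_surface \<alpha> \<beta> f g) u v = 0 \<longleftrightarrow> minimal_eq u"
proof -
  let ?K = "{0..<2 * pi}" and ?X = "rot_surface \<alpha> \<beta> f g" and ?R = "rot_frame_vec \<alpha> \<beta>"
  have K: "at t within ?K \<noteq> bot" if "t \<in> ?K" for t
    using that by (intro at_within_interval_neq_bot) (auto simp: is_interval_co)
  have Xu: "partial_u J ?X s t = ?R t (f1 s) 0 (g1 s) 0" if "s \<in> J" for s t
    unfolding partial_u_def rot_surface_eq_frame_vec
    by (rule vector_derivative_within[OF at_within_J[OF that]])
      (intro rot_frame_vec_has_vector_derivative_coeffs f_deriv g_deriv that)
  have Xv: "partial_v ?K ?X s t = ?R t 0 (\<alpha> * f s) 0 (\<beta> * g s)" if "t \<in> ?K" for s t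
    unfolding partial_v_def rot_surface_eq_frame_vec
    using rot_frame_vec_has_vector_derivative_angle[of \<alpha> \<beta> "f s" 0 "g s" 0 t ?K]
    by (intro vector_derivative_within[OF K[OF that]]) simp
  have Xuu: "partial_u J (partial_u J ?X) u v = ?R v (f2 u) 0 (g2 u) 0"
    unfolding partial_u_def[of J "partial_u J ?X"]
    by (rule vector_derivative_within[OF at_within_J[OF u]
          has_vector_derivative_transform[OF u Xu
            rot_frame_vec_has_vector_derivative_coeffs[OF f1_deriv g1_deriv]]]) (simp_all add: u)
  have Xvv: "partial_v ?K (partial_v ?K ?X) u v = ?R v (- \<alpha>\<^sup>2 * f u) 0 (- \<beta>\<^sup>2 * g u) 0"
    unfolding partial_v_def[of ?K "partial_v ?K ?X"]
    using rot_frame_vec_has_vector_derivative_angle[of \<alpha> \<beta> 0 "\<alpha> * f u" 0 "\<beta> * g u" v ?K]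
    by (intro vector_derivative_within[OF K[OF v] has_vector_derivative_transform[OF v Xv]])
      (simp_all add: power2_eq_square mult.assoc)
  define E G where "E = (f1 u)\<^sup>2 - (g1 u)\<^sup>2" and "G = \<alpha>\<^sup>2 * (f u)\<^sup>2 - \<beta>\<^sup>2 * (g u)\<^sup>2"
  have EG: "E > 0" "G < 0" using E_pos[OF u] G_neg[OF u] by (simp_all add: E_def G_def)
  have inner: "neutral_inner (?R v (f1 u) 0 (g1 u) 0) (?R v (f1 u) 0 (g1 u) 0) = E"
    "neutral_inner (?R v 0 (\<alpha> * f u) 0 (\<beta> * g u)) (?R v 0 (\<alpha> * f u) 0 (\<beta> * g u)) = G"
    "neutral_inner (?R v (f1 u) 0 (g1 u) 0) (?R v 0 (\<alpha> * f u) 0 (\<beta> * g u)) = 0"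
    by (simp_all add: neutral_inner_rot_frame_vec E_def G_def power2_eq_square algebra_simps)
  define P Q where "P = f2 u / E - \<alpha>\<^sup>2 * f u / G" and "Q = g2 u / E - \<beta>\<^sup>2 * g u / G"
  have tr: "(1 / E) *\<^sub>R ?R v (f2 u) 0 (g2 u) 0 + (1 / G) *\<^sub>R ?R v (- \<alpha>\<^sup>2 * f u) 0 (- \<beta>\<^sup>2 * g u) 0
      = ?R v P 0 Q 0"
    by (simp add: rot_frame_vec_lin P_def Q_def)
  have "mean_curvature_vector J ?K ?X u v = (1 / 2) *\<^sub>R normal_part J ?K ?X u v (?R v P 0 Q 0)"
    using mean_curvature_vector_orthogonal[of J ?X u v ?K] EG
    by (simp only: Xu[OF u] Xv[OF v] Xuu Xvv inner tr)
  also have "normal_part J ?K ?X u v (?R v P 0 Q 0) =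
      ?R v (P - (P * f1 u - Q * g1 u) / E * f1 u) 0 (Q - (P * f1 u - Q * g1 u) / E * g1 u) 0"
    using normal_part_orthogonal[of J ?X u v ?K "?R v P 0 Q 0"] EG
    by (simp only: Xu[OF u] Xv[OF v] inner)
      (simp add: neutral_inner_rot_frame_vec rot_frame_vec_lin)
  finally have "mean_curvature_vector J ?K ?X u v = 0 \<longleftrightarrow>
      P * E = (P * f1 u - Q * g1 u) * f1 u \<and> Q * E = (P * f1 u - Q * g1 u) * g1 u"
    using EG by (simp add: rot_frame_vec_eq_0_iff field_simps)
  also have "\<dots> \<longleftrightarrow> g1 u * (Q * f1 u - P * g1 u) = 0 \<and> f1 u * (Q * f1 u - P * g1 u) = 0"
    by (simp add: E_def power2_eq_square algebra_simps)
  also have "\<dots> \<longleftrightarrow> Q * f1 u = P * g1 u"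
    using f1_nonzero[OF u] by auto
  also have "\<dots> \<longleftrightarrow> minimal_eq u"
    unfolding minimal_eq_def P_def Q_def E_def[symmetric] G_def[symmetric]
    using EG by (simp add: field_simps)
  finally show ?thesis .
qed

lemma minimal_surface_iff:
  "minimal_surface J {0..<2 * pi} (rot_surface \<alpha> \<beta> f g) \<longleftrightarrow> (\<forall>u\<in>J. minimal_eq u)"
proof -
  have "0 \<in> {0..<2 * pi}" by simp
  then show ?thesis
    unfolding minimal_surface_def using mean_curvature_vector_eq_0_iff by blast
qed


lemma meridian_bound: "u \<in> J \<Longrightarrow> \<alpha>\<^sup>2 * (f u)\<^sup>2 < \<beta>\<^sup>2 * (g u)\<^sup>2"
  using G_neg[of u] by simp

lemma g_nonzero:
  assumes "u \<in> J"
  shows "g u \<noteq> 0"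
proof
  assume "g u = 0"
  then have "\<alpha>\<^sup>2 * (f u)\<^sup>2 < 0" using meridian_bound[OF assms] by simp
  moreover have "0 \<le> \<alpha>\<^sup>2 * (f u)\<^sup>2" by simp
  ultimately show False by linarith
qed

section \<open>Integrating the differential equation\<close>

text \<open>The derivative of the quotient is \<open>2 f' g' / E\<^sup>2\<close> times the defect of the differential equation.
  The lower bound holds because replacing \<open>\<alpha>\<^sup>2 f\<^sup>2\<close> by the larger \<open>\<beta>\<^sup>2 g\<^sup>2\<close> in the numerator leaves
  \<open>\<beta>\<^sup>2 g\<^sup>2 E\<close>.\<close>

lemma first_integral:
  assumes ode: "\<And>u. u \<in> J \<Longrightarrow> minimal_eq u"
  obtains A where "A > 0" and "\<And>u. u \<in> J \<Longrightarrow> \<beta>\<^sup>2 * (g u)\<^sup>2 \<le> A"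
    and "\<And>u. u \<in> J \<Longrightarrow> A * ((f1 u)\<^sup>2 - (g1 u)\<^sup>2) = \<beta>\<^sup>2 * (g u)\<^sup>2 * (f1 u)\<^sup>2 - \<alpha>\<^sup>2 * (f u)\<^sup>2 * (g1 u)\<^sup>2"
proof -
  define N D where "N u = \<beta>\<^sup>2 * (g u)\<^sup>2 * (f1 u)\<^sup>2 - \<alpha>\<^sup>2 * (f u)\<^sup>2 * (g1 u)\<^sup>2"
    and "D u = (f1 u)\<^sup>2 - (g1 u)\<^sup>2" for u
  have "((\<lambda>u. N u / D u) has_real_derivative 0) (at u within J)" if u: "u \<in> J" for u
  proof -
    note d = f_deriv[OF u] g_deriv[OF u] f1_deriv[OF u] g1_deriv[OF u]
    define N' D' where "N' = 2 * (\<beta>\<^sup>2 * g u * g1 u * (f1 u)\<^sup>2 + \<beta>\<^sup>2 * (g u)\<^sup>2 * f1 u * f2 u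
        - \<alpha>\<^sup>2 * f u * f1 u * (g1 u)\<^sup>2 - \<alpha>\<^sup>2 * (f u)\<^sup>2 * g1 u * g2 u)"
      and "D' = 2 * (f1 u * f2 u - g1 u * g2 u)"
    have dN: "(N has_real_derivative N') (at u within J)"
      unfolding N_def N'_def
      by (rule derivative_eq_intros d refl)+ (simp add: algebra_simps)
    have dD: "(D has_real_derivative D') (at u within J)"
      unfolding D_def D'_def by (rule derivative_eq_intros d refl)+ (simp add: algebra_simps)
    have "N' * D u - N u * D' = 2 * f1 u * g1 u *
        (((f1 u)\<^sup>2 - (g1 u)\<^sup>2) * (\<beta>\<^sup>2 * g u * f1 u - \<alpha>\<^sup>2 * f u * g1 u) -
         (\<alpha>\<^sup>2 * (f u)\<^sup>2 - \<beta>\<^sup>2 * (g u)\<^sup>2) * (f1 u * g2 u - g1 u * f2 u))"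
      unfolding N_def D_def N'_def D'_def by algebra
    also have "\<dots> = 0" using ode[OF u] by (simp add: minimal_eq_def)
    finally show ?thesis
      using DERIV_divide[OF dN dD] E_pos[OF u] by (simp add: D_def)
  qed
  from has_field_derivative_zero_constant[OF _ this] interval(1)
  obtain A where A: "\<And>u. u \<in> J \<Longrightarrow> N u / D u = A"
    by (auto simp: is_interval_convex)
  have eq: "A * D u = N u" if "u \<in> J" for u
    using A[OF that] E_pos[OF that] by (auto simp: D_def)
  have ge: "\<beta>\<^sup>2 * (g u)\<^sup>2 \<le> A" if u: "u \<in> J" for u
  proof -
    have "\<beta>\<^sup>2 * (g u)\<^sup>2 * D u \<le> N u"
      using mult_right_mono[of "\<alpha>\<^sup>2 * (f u)\<^sup>2" "\<beta>\<^sup>2 * (g u)\<^sup>2" "(g1 u)\<^sup>2"] meridian_bound[OF u]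
      by (simp add: N_def D_def algebra_simps)
    then show ?thesis using eq[OF u] E_pos[OF u] by (simp add: D_def flip: eq[OF u])
  qed
  obtain u where "u \<in> J" using J_nonempty by auto
  then have "A > 0"
    using ge[of u] g_nonzero[of u] pos by (smt (verit) mult_pos_pos zero_less_power2)
  then show ?thesis
    using that ge eq by (simp add: N_def D_def)
qed

text \<open>The hypothesis is the first integral in the form it takes for \<open>W\<^sup>2 = A - \<alpha>\<^sup>2 f\<^sup>2\<close>. It turns the
  differential equation into one for the derivative \<open>(f' g'' - g' f'') / f'\<^sup>2\<close> of the slope \<open>g' / f'\<close>,
  with \<open>E\<close> and \<open>G\<close> eliminated.\<close>

lemma minimal_eq_iff:
  assumes u: "u \<in> J"
    and W: "W\<^sup>2 * ((f1 u)\<^sup>2 - (g1 u)\<^sup>2) = (\<beta>\<^sup>2 * (g u)\<^sup>2 - \<alpha>\<^sup>2 * (f u)\<^sup>2) * (f1 u)\<^sup>2"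
  shows "minimal_eq u \<longleftrightarrow>
    (f1 u * g2 u - g1 u * f2 u) * W\<^sup>2 = (f1 u)\<^sup>2 * (\<alpha>\<^sup>2 * f u * g1 u - \<beta>\<^sup>2 * g u * f1 u)"
proof -
  let ?G = "\<alpha>\<^sup>2 * (f u)\<^sup>2 - \<beta>\<^sup>2 * (g u)\<^sup>2" and ?E = "(f1 u)\<^sup>2 - (g1 u)\<^sup>2"
  let ?k = "f1 u * g2 u - g1 u * f2 u" and ?r = "\<beta>\<^sup>2 * g u * f1 u - \<alpha>\<^sup>2 * f u * g1 u"
  have "minimal_eq u \<longleftrightarrow> (f1 u)\<^sup>2 * (?G * ?k) = (f1 u)\<^sup>2 * (?E * ?r)"
    using f1_nonzero[OF u] by (simp add: minimal_eq_def)
  also have "(f1 u)\<^sup>2 * (?G * ?k) = - (?E * (?k * W\<^sup>2))"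
    using W by algebra
  also have "- (?E * (?k * W\<^sup>2)) = (f1 u)\<^sup>2 * (?E * ?r) \<longleftrightarrow>
      ?E * (?k * W\<^sup>2) = ?E * ((f1 u)\<^sup>2 * (- ?r))"
    by (auto simp: algebra_simps)
  also have "\<dots> \<longleftrightarrow> ?k * W\<^sup>2 = (f1 u)\<^sup>2 * (- ?r)"
    using E_pos[OF u] by simp
  finally show ?thesis by simp
qed

text \<open>Along a curve with \<open>\<alpha> f = \<surd>A sin (\<alpha> w)\<close> this is \<open>\<beta> w\<close>, the angle at which \<open>\<beta> g\<close> oscillates.\<close>

definition phase :: "real \<Rightarrow> real \<Rightarrow> real" where
  "phase A u = (\<beta> / \<alpha>) * arcsin (\<alpha> * f u / sqrt A)"

lemma phase_deriv:
  assumes u: "u \<in> J" and A: "\<alpha>\<^sup>2 * (f u)\<^sup>2 < A"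
  shows "(phase A has_real_derivative \<beta> * f1 u / sqrt (A - \<alpha>\<^sup>2 * (f u)\<^sup>2)) (at u within J)"
proof -
  have "A > 0" using A by (smt (verit) zero_le_mult_iff zero_le_power2)
  have sq: "(\<alpha> * f u / sqrt A)\<^sup>2 = \<alpha>\<^sup>2 * (f u)\<^sup>2 / A"
    using \<open>A > 0\<close> by (simp add: power_divide power_mult_distrib)
  then have "(\<alpha> * f u / sqrt A)\<^sup>2 < 1" using A \<open>A > 0\<close> by simp
  then have bd: "-1 < \<alpha> * f u / sqrt A" "\<alpha> * f u / sqrt A < 1"
    unfolding abs_square_less_1 by linarith+
  have "1 - (\<alpha> * f u / sqrt A)\<^sup>2 = (A - \<alpha>\<^sup>2 * (f u)\<^sup>2) / A"
    unfolding sq using \<open>A > 0\<close> by (simp add: field_simps)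
  then have root: "sqrt (1 - (\<alpha> * f u / sqrt A)\<^sup>2) = sqrt (A - \<alpha>\<^sup>2 * (f u)\<^sup>2) / sqrt A"
    by (simp only: real_sqrt_divide)
  have "(phase A has_real_derivative
      \<beta> / \<alpha> * (inverse (sqrt (1 - (\<alpha> * f u / sqrt A)\<^sup>2)) * (\<alpha> * f1 u / sqrt A))) (at u within J)"
    unfolding phase_def
    by (intro DERIV_cmult DERIV_chain2[where f = arcsin] DERIV_arcsin bd DERIV_cdivide f_deriv u)
  also have "\<beta> / \<alpha> * (inverse (sqrt (1 - (\<alpha> * f u / sqrt A)\<^sup>2)) * (\<alpha> * f1 u / sqrt A))
      = \<beta> * f1 u / sqrt (A - \<alpha>\<^sup>2 * (f u)\<^sup>2)"
    unfolding root using pos \<open>A > 0\<close> by simp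
  finally show ?thesis .
qed

lemma radius_deriv:
  assumes u: "u \<in> J" and A: "\<alpha>\<^sup>2 * (f u)\<^sup>2 < A"
  shows "((\<lambda>u. sqrt (A - \<alpha>\<^sup>2 * (f u)\<^sup>2)) has_real_derivative
     - (\<alpha>\<^sup>2 * f u * f1 u) / sqrt (A - \<alpha>\<^sup>2 * (f u)\<^sup>2)) (at u within J)"
  using f_deriv[OF u] A
  by (auto intro!: derivative_eq_intros simp: field_simps)

text \<open>With respect to the phase \<open>\<theta>\<close>, the functions \<open>h = \<beta> g\<close> and \<open>k = (g' / f') \<surd>(A - \<alpha>\<^sup>2 f\<^sup>2)\<close> satisfy
  \<open>h' = k\<close> and \<open>k' = - h\<close>: the first by the definition of \<open>k\<close>, the second by the differential equation.
  So rotating \<open>(h, k)\<close> back by \<open>\<theta>\<close> gives constants \<open>(p, q)\<close>, and the first integral says that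
  \<open>p\<^sup>2 + q\<^sup>2 = A\<close>.\<close>

lemma minimal_imp_sine_relation:
  assumes ode: "\<And>u. u \<in> J \<Longrightarrow> minimal_eq u"
  obtains A \<delta> where "A > 0" and "\<And>u. u \<in> J \<Longrightarrow> \<beta> * g u = sqrt A * sin (phase A u + \<delta>)"
proof -
  obtain A where A: "A > 0" and ge: "\<And>u. u \<in> J \<Longrightarrow> \<beta>\<^sup>2 * (g u)\<^sup>2 \<le> A"
    and int: "\<And>u. u \<in> J \<Longrightarrow>
      A * ((f1 u)\<^sup>2 - (g1 u)\<^sup>2) = \<beta>\<^sup>2 * (g u)\<^sup>2 * (f1 u)\<^sup>2 - \<alpha>\<^sup>2 * (f u)\<^sup>2 * (g1 u)\<^sup>2"
    using first_integral ode by metis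
  define W where "W u = sqrt (A - \<alpha>\<^sup>2 * (f u)\<^sup>2)" for u
  define h k where "h u = \<beta> * g u" and "k u = g1 u / f1 u * W u" for u
  let ?\<theta> = "phase A" and ?\<theta>' = "\<lambda>u. \<beta> * f1 u / W u"
  have less: "\<alpha>\<^sup>2 * (f u)\<^sup>2 < A" if "u \<in> J" for u
    using meridian_bound[OF that] ge[OF that] by simp
  have W: "W u > 0" "(W u)\<^sup>2 = A - \<alpha>\<^sup>2 * (f u)\<^sup>2" if "u \<in> J" for u
    using less[OF that] by (simp_all add: W_def)
  have d\<theta>: "(?\<theta> has_real_derivative ?\<theta>' u) (at u within J)" if "u \<in> J" for u
    unfolding W_def using that less[OF that] by (rule phase_deriv)
  have dW: "(W has_real_derivative - (\<alpha>\<^sup>2 * f u * f1 u) / W u) (at u within J)" if "u \<in> J" for u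
    using radius_deriv[OF that less[OF that]] unfolding W_def .
  have dh: "(h has_real_derivative k u * ?\<theta>' u) (at u within J)" if "u \<in> J" for u
    unfolding h_def k_def
    by (rule derivative_eq_intros g_deriv that refl)+
      (use W[OF that] f1_nonzero[OF that] in simp)
  have dk: "(k has_real_derivative - h u * ?\<theta>' u) (at u within J)" if u: "u \<in> J" for u
  proof -
    have "(W u)\<^sup>2 * ((f1 u)\<^sup>2 - (g1 u)\<^sup>2) = (\<beta>\<^sup>2 * (g u)\<^sup>2 - \<alpha>\<^sup>2 * (f u)\<^sup>2) * (f1 u)\<^sup>2"
      using int[OF u] W(2)[OF u] by algebra
    from minimal_eq_iff[OF u this] ode[OF u]
    have eq: "(f1 u * g2 u - g1 u * f2 u) * (W u)\<^sup>2 =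
        (f1 u)\<^sup>2 * (\<alpha>\<^sup>2 * f u * g1 u - \<beta>\<^sup>2 * g u * f1 u)" by simp
    have "(k has_real_derivative (g2 u * f1 u - g1 u * f2 u) / (f1 u)\<^sup>2 * W u
        - g1 u / f1 u * (\<alpha>\<^sup>2 * f u * f1 u / W u)) (at u within J)"
      unfolding k_def
      by (rule derivative_eq_intros f1_deriv g1_deriv dW u f1_nonzero refl)+
        (simp add: power2_eq_square)
    also have "(g2 u * f1 u - g1 u * f2 u) / (f1 u)\<^sup>2 * W u - g1 u / f1 u * (\<alpha>\<^sup>2 * f u * f1 u / W u)
      = ((f1 u * g2 u - g1 u * f2 u) * (W u)\<^sup>2 - (f1 u)\<^sup>2 * (\<alpha>\<^sup>2 * f u * g1 u)) / ((f1 u)\<^sup>2 * W u)"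
      using W(1)[OF u] f1_nonzero[OF u] by (simp add: field_simps power2_eq_square)
    also have "\<dots> = - h u * ?\<theta>' u"
      unfolding eq h_def using W(1)[OF u] f1_nonzero[OF u] by (simp add: field_simps power2_eq_square)
    finally show ?thesis .
  qed
  have "((\<lambda>u. h u * cos (?\<theta> u) - k u * sin (?\<theta> u)) has_real_derivative 0) (at u within J)"
    if "u \<in> J" for u
    by (rule derivative_eq_intros dh dk d\<theta> that refl)+ (simp add: algebra_simps)
  from has_field_derivative_zero_constant[OF _ this] interval(1)
  obtain p where p: "\<And>u. u \<in> J \<Longrightarrow> h u * cos (?\<theta> u) - k u * sin (?\<theta> u) = p"
    by (auto simp: is_interval_convex)
  have "((\<lambda>u. h u * sin (?\<theta> u) + k u * cos (?\<theta> u)) has_real_derivative 0) (at u within J)"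
    if "u \<in> J" for u
    by (rule derivative_eq_intros dh dk d\<theta> that refl)+ (simp add: algebra_simps)
  from has_field_derivative_zero_constant[OF _ this] interval(1)
  obtain q where q: "\<And>u. u \<in> J \<Longrightarrow> h u * sin (?\<theta> u) + k u * cos (?\<theta> u) = q"
    by (auto simp: is_interval_convex)
  have "p\<^sup>2 + q\<^sup>2 = A"
  proof -
    obtain u where u: "u \<in> J" using J_nonempty by auto
    have "p\<^sup>2 + q\<^sup>2 = (h u)\<^sup>2 + (k u)\<^sup>2"
      using sin_cos_squared_add[of "?\<theta> u"] unfolding p[OF u, symmetric] q[OF u, symmetric] by algebra
    moreover have "(f1 u)\<^sup>2 * (k u)\<^sup>2 = (g1 u)\<^sup>2 * (W u)\<^sup>2"
      using f1_nonzero[OF u] by (simp add: k_def field_simps)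
    then have "(f1 u)\<^sup>2 * ((h u)\<^sup>2 + (k u)\<^sup>2) = (f1 u)\<^sup>2 * A"
      using int[OF u] W(2)[OF u] unfolding h_def by algebra
    ultimately show ?thesis using f1_nonzero[OF u] by simp
  qed
  then have "(q / sqrt A)\<^sup>2 + (p / sqrt A)\<^sup>2 = 1"
    using A by (simp add: power_divide add.commute flip: add_divide_distrib)
  then obtain \<delta> where "q / sqrt A = cos \<delta>" "p / sqrt A = sin \<delta>"
    by (rule sincos_total_2pi)
  then have pq: "q = sqrt A * cos \<delta>" "p = sqrt A * sin \<delta>" using A by (auto simp: field_simps)
  show ?thesis
  proof (rule that[OF A])
    fix u assume u: "u \<in> J"
    have "h u = p * cos (?\<theta> u) + q * sin (?\<theta> u)"
      using sin_cos_squared_add[of "?\<theta> u"] p[OF u] q[OF u] by algebra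
    then show "\<beta> * g u = sqrt A * sin (?\<theta> u + \<delta>)"
      by (simp add: h_def pq sin_add algebra_simps)
  qed
qed

lemma sine_relation_bound:
  assumes A: "A > 0" and u: "u \<in> J" and eq: "\<beta> * g u = sqrt A * sin \<theta>"
  shows "\<alpha>\<^sup>2 * (f u)\<^sup>2 < A" "\<bar>\<alpha> * f u / sqrt A\<bar> < 1"
proof -
  have "\<beta>\<^sup>2 * (g u)\<^sup>2 = (sqrt A * sin \<theta>)\<^sup>2" by (simp add: power_mult_distrib flip: eq)
  also have "\<dots> = A * (sin \<theta>)\<^sup>2" using A by (simp add: power_mult_distrib)
  also have "\<dots> \<le> A" using A by (simp add: abs_square_le_1)
  finally show less: "\<alpha>\<^sup>2 * (f u)\<^sup>2 < A" using meridian_bound[OF u] by simp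
  have "(\<alpha> * f u / sqrt A)\<^sup>2 = \<alpha>\<^sup>2 * (f u)\<^sup>2 / A"
    using A by (simp add: power_divide power_mult_distrib)
  also have "\<dots> < 1" using less A by simp
  finally show "\<bar>\<alpha> * f u / sqrt A\<bar> < 1" by (simp only: abs_square_less_1)
qed

text \<open>Differentiating the sine relation gives \<open>g' W = f' \<surd>A cos (\<theta> + \<delta>)\<close> with \<open>W\<^sup>2 = A - \<alpha>\<^sup>2 f\<^sup>2\<close>,
  and differentiating this once more gives the equation for the slope in \<open>minimal_eq_iff\<close>.\<close>

lemma sine_relation_imp_minimal:
  assumes A: "A > 0" and rel: "\<And>u. u \<in> J \<Longrightarrow> \<beta> * g u = sqrt A * sin (phase A u + \<delta>)"
    and u: "u \<in> J"
  shows "minimal_eq u"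
proof -
  define W where "W u = sqrt (A - \<alpha>\<^sup>2 * (f u)\<^sup>2)" for u
  define S C where "S u = sqrt A * sin (phase A u + \<delta>)" and "C u = sqrt A * cos (phase A u + \<delta>)" for u
  have less: "\<alpha>\<^sup>2 * (f u)\<^sup>2 < A" if "u \<in> J" for u
    using sine_relation_bound(1)[OF A that rel[OF that]] .
  have W: "W u > 0" "(W u)\<^sup>2 = A - \<alpha>\<^sup>2 * (f u)\<^sup>2" if "u \<in> J" for u
    using less[OF that] by (simp_all add: W_def)
  have d\<theta>: "(phase A has_real_derivative \<beta> * f1 u / W u) (at u within J)" if "u \<in> J" for u
    unfolding W_def using that less[OF that] by (rule phase_deriv)
  have dW: "(W has_real_derivative - (\<alpha>\<^sup>2 * f u * f1 u) / W u) (at u within J)" if "u \<in> J" for u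
    using radius_deriv[OF that less[OF that]] unfolding W_def .
  have dS: "(S has_real_derivative C u * (\<beta> * f1 u / W u)) (at u within J)" if "u \<in> J" for u
    unfolding S_def C_def by (rule derivative_eq_intros d\<theta> that refl)+ simp
  have dC: "(C has_real_derivative - S u * (\<beta> * f1 u / W u)) (at u within J)" if "u \<in> J" for u
    unfolding S_def C_def by (rule derivative_eq_intros d\<theta> that refl)+ simp
  have SC: "(S u)\<^sup>2 + (C u)\<^sup>2 = A" for u
    using A by (simp add: S_def C_def power_mult_distrib flip: distrib_left)
  have slope: "g1 u * W u - C u * f1 u = 0" if u: "u \<in> J" for u
  proof -
    have "((\<lambda>u. \<beta> * g u) has_real_derivative C u * (\<beta> * f1 u / W u)) (at u within J)"
      by (rule has_field_derivative_transform_within[OF dS[OF u] zero_less_one u])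
        (simp add: rel S_def)
    moreover have "((\<lambda>u. \<beta> * g u) has_real_derivative \<beta> * g1 u) (at u within J)"
      by (rule derivative_eq_intros g_deriv u refl)+ simp
    ultimately have "C u * (\<beta> * f1 u / W u) = \<beta> * g1 u"
      using at_within_J[OF u] by (rule has_field_derivative_unique)
    then show ?thesis using pos W(1)[OF u] by (simp add: field_simps)
  qed
  have "((\<lambda>u. g1 u * W u - C u * f1 u) has_real_derivative
      g2 u * W u - g1 u * (\<alpha>\<^sup>2 * f u * f1 u / W u)
      + S u * (\<beta> * f1 u / W u) * f1 u - C u * f2 u) (at u within J)"
    by (rule derivative_eq_intros g1_deriv f1_deriv dW dC u refl)+ (simp add: algebra_simps)
  moreover have "((\<lambda>u. g1 u * W u - C u * f1 u) has_real_derivative 0) (at u within J)"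
    by (rule has_field_derivative_transform_within[OF DERIV_const zero_less_one u])
      (simp add: slope)
  ultimately have "g2 u * W u - g1 u * (\<alpha>\<^sup>2 * f u * f1 u / W u)
      + S u * (\<beta> * f1 u / W u) * f1 u - C u * f2 u = 0"
    using at_within_J[OF u] by (rule has_field_derivative_unique)
  moreover have "(g2 u * W u - g1 u * (\<alpha>\<^sup>2 * f u * f1 u / W u)
      + S u * (\<beta> * f1 u / W u) * f1 u - C u * f2 u) * W u =
      g2 u * (W u)\<^sup>2 - g1 u * \<alpha>\<^sup>2 * f u * f1 u + S u * \<beta> * f1 u * f1 u - C u * f2 u * W u"
    using W(1)[OF u] by (simp add: field_simps power2_eq_square)
  ultimately have
    "g2 u * (W u)\<^sup>2 - g1 u * \<alpha>\<^sup>2 * f u * f1 u + S u * \<beta> * f1 u * f1 u - C u * f2 u * W u = 0"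
    by simp
  moreover have S: "S u = \<beta> * g u" using rel[OF u] by (simp add: S_def)
  ultimately have "(f1 u * g2 u - g1 u * f2 u) * (W u)\<^sup>2 =
      (f1 u)\<^sup>2 * (\<alpha>\<^sup>2 * f u * g1 u - \<beta>\<^sup>2 * g u * f1 u)"
    using slope[OF u] by algebra
  moreover have "(W u)\<^sup>2 * ((f1 u)\<^sup>2 - (g1 u)\<^sup>2) = (\<beta>\<^sup>2 * (g u)\<^sup>2 - \<alpha>\<^sup>2 * (f u)\<^sup>2) * (f1 u)\<^sup>2"
    using slope[OF u] SC[of u] S W(2)[OF u] by algebra
  ultimately show ?thesis using minimal_eq_iff[OF u] by simp
qed

section \<open>The three relations between the meridian functions\<close>

text \<open>The logarithmic derivative of the relation is \<open>f' / f = p g' / g\<close>; squared and cleared of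
  denominators it reads \<open>\<beta>\<^sup>2 g\<^sup>2 f'\<^sup>2 = \<alpha>\<^sup>2 f\<^sup>2 g'\<^sup>2\<close>, whereas the left side is strictly larger.\<close>

lemma not_power_relation:
  assumes p: "\<bar>p\<bar> = \<alpha> / \<beta>" and rel: "\<And>u. u \<in> J \<Longrightarrow> f u = c * \<bar>g u\<bar> powr p"
  shows False
proof -
  obtain u where u: "u \<in> J" using J_nonempty by auto
  \<comment> \<open>This form is differentiable without knowing the sign of \<open>g\<close>.\<close>
  have powr: "\<bar>g u\<bar> powr p = exp (p / 2 * ln ((g u)\<^sup>2))" if "u \<in> J" for u
    using g_nonzero[OF that] ln_realpow[of "\<bar>g u\<bar>" 2] by (simp add: powr_def)
  have "((\<lambda>u. c * exp (p / 2 * ln ((g u)\<^sup>2))) has_real_derivative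
      c * exp (p / 2 * ln ((g u)\<^sup>2)) * (p * g1 u / g u)) (at u within J)"
    using g_nonzero[OF u] g_deriv[OF u]
    by (auto intro!: derivative_eq_intros simp: field_simps power2_eq_square)
      (metis not_real_square_gt_zero)
  then have "(f has_real_derivative f u * (p * g1 u / g u)) (at u within J)"
    unfolding rel[OF u] powr[OF u]
    by (rule has_field_derivative_transform_within[OF _ zero_less_one u]) (simp add: rel powr)
  then have "f1 u = f u * (p * g1 u / g u)"
    using has_field_derivative_unique[OF f_deriv[OF u] _ at_within_J[OF u]] by blast
  then have "f1 u * g u = p * (f u * g1 u)" using g_nonzero[OF u] by simp
  then have "(f1 u)\<^sup>2 * (g u)\<^sup>2 = \<bar>p\<bar>\<^sup>2 * ((f u)\<^sup>2 * (g1 u)\<^sup>2)"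
    by (simp flip: power_mult_distrib)
  then have "\<beta>\<^sup>2 * (g u)\<^sup>2 * (f1 u)\<^sup>2 = \<alpha>\<^sup>2 * (f u)\<^sup>2 * (g1 u)\<^sup>2"
    unfolding p using pos by (simp add: field_simps)
  moreover have "\<alpha>\<^sup>2 * (f u)\<^sup>2 * (g1 u)\<^sup>2 \<le> \<alpha>\<^sup>2 * (f u)\<^sup>2 * (f1 u)\<^sup>2"
    using E_pos[OF u] by (intro mult_left_mono) auto
  moreover have "\<alpha>\<^sup>2 * (f u)\<^sup>2 * (f1 u)\<^sup>2 < \<beta>\<^sup>2 * (g u)\<^sup>2 * (f1 u)\<^sup>2"
    using meridian_bound[OF u] f1_nonzero[OF u] by (intro mult_strict_right_mono) auto
  ultimately show False by simp
qed

lemma sine_relation_imp_arcsin_relation: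
  assumes A: "A > 0" and rel: "\<And>u. u \<in> J \<Longrightarrow> \<beta> * g u = sqrt A * sin (phase A u + \<delta>)"
  shows "\<exists>\<theta>. arcsin_branch_on J (\<lambda>u. \<beta> * g u / sqrt A) \<theta> \<and>
     (\<forall>u\<in>J. \<bar>\<alpha> * f u / sqrt A\<bar> \<le> 1 \<and>
        arcsin (\<alpha> * f u / sqrt A) = 1 * (\<alpha> / \<beta>) * \<theta> u + - (\<alpha> / \<beta>) * \<delta>)"
proof (intro exI conjI ballI)
  have "continuous_on J (phase A)"
    using phase_deriv sine_relation_bound(1)[OF A _ rel]
    by (meson DERIV_continuous continuous_on_eq_continuous_within)
  then show "arcsin_branch_on J (\<lambda>u. \<beta> * g u / sqrt A) (\<lambda>u. phase A u + \<delta>)"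
    using A rel by (auto simp: arcsin_branch_on_def intro!: continuous_intros)
  fix u assume u: "u \<in> J"
  show "\<bar>\<alpha> * f u / sqrt A\<bar> \<le> 1" using sine_relation_bound(2)[OF A u rel[OF u]] by simp
  show "arcsin (\<alpha> * f u / sqrt A) = 1 * (\<alpha> / \<beta>) * (phase A u + \<delta>) + - (\<alpha> / \<beta>) * \<delta>"
    using pos by (simp add: phase_def field_simps)
qed

lemma arcsin_relation_imp_sine_relation:
  assumes A: "A > 0" and s: "s \<in> {1, -1}"
    and \<theta>: "arcsin_branch_on J (\<lambda>u. \<beta> * g u / sqrt A) \<theta>"
    and rel: "\<And>u. u \<in> J \<Longrightarrow> arcsin (\<alpha> * f u / sqrt A) = s * (\<alpha> / \<beta>) * \<theta> u + C"
  obtains \<delta> where "\<And>u. u \<in> J \<Longrightarrow> \<beta> * g u = sqrt A * sin (phase A u + \<delta>)"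
proof -
  have g: "\<beta> * g u = sqrt A * sin (\<theta> u)" if "u \<in> J" for u
    using \<theta> A that by (simp add: arcsin_branch_on_def)
  have ph: "phase A u = s * \<theta> u + \<beta> / \<alpha> * C" if "u \<in> J" for u
    using rel[OF that] pos by (simp add: phase_def field_simps)
  show ?thesis
  proof (cases "s = 1")
    case True
    then show ?thesis using that[of "- \<beta> / \<alpha> * C"] g ph by simp
  next
    case False
    then have "s = -1" using s by simp
    then have "phase A u + (pi - \<beta> / \<alpha> * C) = pi - \<theta> u" if "u \<in> J" for u
      using ph[OF that] by simp
    then have "\<beta> * g u = sqrt A * sin (phase A u + (pi - \<beta> / \<alpha> * C))" if "u \<in> J" for u
      using g that by (simp only: sin_pi_minus)
    then show ?thesis by (rule that)
  qed
qed

text \<open>With \<open>\<psi> = \<theta> + \<delta> / 2\<close>, the functions \<open>\<alpha> f\<close> and \<open>\<alpha> g\<close> are \<open>\<surd>A sin (\<psi> \<mp> \<delta> / 2)\<close>, so their sum and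
  difference are \<open>2 \<surd>A sin \<psi> cos (\<delta> / 2)\<close> and \<open>- 2 \<surd>A cos \<psi> sin (\<delta> / 2)\<close>. Neither of them vanishes,
  since \<open>f\<^sup>2 < g\<^sup>2\<close>; therefore \<open>\<psi>\<close> can be eliminated and \<open>a \<noteq> 0\<close>.\<close>

lemma sine_relation_imp_quadratic_relation:
  assumes \<alpha>\<beta>: "\<alpha> = \<beta>"
    and A: "A > 0" and rel: "\<And>u. u \<in> J \<Longrightarrow> \<beta> * g u = sqrt A * sin (phase A u + \<delta>)"
  shows "\<exists>a b. a \<noteq> 0 \<and> (\<forall>u\<in>J. (f u + g u)\<^sup>2 = a * (f u - g u)\<^sup>2 + b)"
proof -
  define c s where "c = cos (\<delta> / 2)" and "s = sin (\<delta> / 2)"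
  define \<psi> where "\<psi> u = phase A u + \<delta> / 2" for u
  have sum: "\<alpha> * (f u + g u) = 2 * sqrt A * sin (\<psi> u) * c"
    and diff: "\<alpha> * (f u - g u) = - 2 * sqrt A * cos (\<psi> u) * s" if u: "u \<in> J" for u
  proof -
    have "\<beta> / \<alpha> = 1" using \<alpha>\<beta> pos by simp
    then have "\<psi> u - \<delta> / 2 = arcsin (\<alpha> * f u / sqrt A)"
      unfolding \<psi>_def phase_def by (simp only:)
    moreover have "sin (arcsin (\<alpha> * f u / sqrt A)) = \<alpha> * f u / sqrt A"
      using sine_relation_bound(2)[OF A u rel[OF u]] by (intro sin_arcsin) linarith+
    ultimately have "\<alpha> * f u = sqrt A * sin (\<psi> u - \<delta> / 2)"
      using A by simp
    moreover have "\<alpha> * g u = sqrt A * sin (\<psi> u + \<delta> / 2)"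
      using rel[OF u] by (simp add: \<psi>_def add.assoc) (simp add: \<alpha>\<beta>)
    ultimately show "\<alpha> * (f u + g u) = 2 * sqrt A * sin (\<psi> u) * c"
      and "\<alpha> * (f u - g u) = - 2 * sqrt A * cos (\<psi> u) * s"
      by (simp_all add: c_def s_def sin_add sin_diff algebra_simps)
  qed
  have ne: "f u + g u \<noteq> 0" "f u - g u \<noteq> 0" if "u \<in> J" for u
    using meridian_bound[OF that] \<alpha>\<beta> by (auto simp: add_eq_0_iff)
  obtain u where "u \<in> J" using J_nonempty by auto
  then have cs: "c \<noteq> 0" "s \<noteq> 0" using sum[of u] diff[of u] ne[of u] pos by auto
  show ?thesis
  proof (intro exI conjI ballI)
    show "- (c\<^sup>2 / s\<^sup>2) \<noteq> 0" using cs by simp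
    fix u assume u: "u \<in> J"
    have "\<alpha>\<^sup>2 * (f u + g u)\<^sup>2 = 4 * A * (sin (\<psi> u))\<^sup>2 * c\<^sup>2"
      and "\<alpha>\<^sup>2 * (f u - g u)\<^sup>2 = 4 * A * (cos (\<psi> u))\<^sup>2 * s\<^sup>2"
      using sum[OF u] diff[OF u] A by (simp_all add: power_mult_distrib flip: power_mult_distrib[of \<alpha>])
    then have sq: "(f u + g u)\<^sup>2 = 4 * A * (sin (\<psi> u))\<^sup>2 * c\<^sup>2 / \<alpha>\<^sup>2"
      "(f u - g u)\<^sup>2 = 4 * A * (cos (\<psi> u))\<^sup>2 * s\<^sup>2 / \<alpha>\<^sup>2"
      using pos by (simp_all add: field_simps)
    show "(f u + g u)\<^sup>2 = - (c\<^sup>2 / s\<^sup>2) * (f u - g u)\<^sup>2 + 4 * A * c\<^sup>2 / \<alpha>\<^sup>2"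
      using cs pos unfolding sq sin_squared_eq by (simp add: field_simps)
  qed
qed

text \<open>For \<open>p = f + g\<close> and \<open>q = f - g\<close> two differentiations of the relation give \<open>p p' = a q q'\<close> and
  \<open>p'\<^sup>2 + p p'' = a (q'\<^sup>2 + q q'')\<close>. Eliminating \<open>a\<close> leaves the differential equation, because
  \<open>f\<^sup>2 - g\<^sup>2 = p q\<close> and \<open>E = p' q'\<close>.\<close>

lemma quadratic_relation_imp_minimal:
  assumes \<alpha>\<beta>: "\<alpha> = \<beta>" and rel: "\<And>u. u \<in> J \<Longrightarrow> (f u + g u)\<^sup>2 = a * (f u - g u)\<^sup>2 + b"
    and u: "u \<in> J"
  shows "minimal_eq u"
proof -
  have 1: "(f u + g u) * (f1 u + g1 u) - a * ((f u - g u) * (f1 u - g1 u)) = 0"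
    if u: "u \<in> J" for u
  proof -
    have "((\<lambda>u. (f u + g u)\<^sup>2 - a * (f u - g u)\<^sup>2) has_real_derivative
        2 * ((f u + g u) * (f1 u + g1 u) - a * ((f u - g u) * (f1 u - g1 u)))) (at u within J)"
      by (rule derivative_eq_intros f_deriv g_deriv u refl)+ (simp add: algebra_simps)
    moreover have "((\<lambda>u. (f u + g u)\<^sup>2 - a * (f u - g u)\<^sup>2) has_real_derivative 0) (at u within J)"
      by (rule has_field_derivative_transform_within[OF DERIV_const[of b] zero_less_one u])
        (simp add: rel)
    ultimately show ?thesis
      using has_field_derivative_unique at_within_J[OF u] by fastforce
  qed
  have "((\<lambda>u. (f u + g u) * (f1 u + g1 u) - a * ((f u - g u) * (f1 u - g1 u))) has_real_derivative
        (f1 u + g1 u)\<^sup>2 + (f u + g u) * (f2 u + g2 u)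
        - a * ((f1 u - g1 u)\<^sup>2 + (f u - g u) * (f2 u - g2 u))) (at u within J)"
    by (rule derivative_eq_intros f_deriv g_deriv f1_deriv g1_deriv u refl)+
      (simp add: power2_eq_square algebra_simps)
  moreover have "((\<lambda>u. (f u + g u) * (f1 u + g1 u) - a * ((f u - g u) * (f1 u - g1 u)))
      has_real_derivative 0) (at u within J)"
    by (rule has_field_derivative_transform_within[OF DERIV_const[of 0] zero_less_one u])
      (simp add: 1)
  ultimately have 2: "(f1 u + g1 u)\<^sup>2 + (f u + g u) * (f2 u + g2 u)
        - a * ((f1 u - g1 u)\<^sup>2 + (f u - g u) * (f2 u - g2 u)) = 0"
    using at_within_J[OF u] by (rule has_field_derivative_unique)
  have "2 * (((f u)\<^sup>2 - (g u)\<^sup>2) * (f1 u * g2 u - g1 u * f2 u)) =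
      2 * (((f1 u)\<^sup>2 - (g1 u)\<^sup>2) * (g u * f1 u - f u * g1 u))"
    using 1[OF u] 2 by algebra
  then have "\<beta>\<^sup>2 * (((f u)\<^sup>2 - (g u)\<^sup>2) * (f1 u * g2 u - g1 u * f2 u)) =
      \<beta>\<^sup>2 * (((f1 u)\<^sup>2 - (g1 u)\<^sup>2) * (g u * f1 u - f u * g1 u))"
    by simp
  then show ?thesis unfolding minimal_eq_def unfolding \<alpha>\<beta> by (simp add: algebra_simps)
qed

end

theorem theorem4p1:
  fixes \<alpha> \<beta> :: real and f g :: "real \<Rightarrow> real" and J :: "real set"
  assumes "is_interval J" and "interior J \<noteq> {}"
    and "\<alpha> > 0" and "\<beta> > 0"
    and "smooth_fun_on J f" and "smooth_fun_on J g"
    and "\<And>u. u \<in> J \<Longrightarrow> \<alpha>\<^sup>2 * (f u)\<^sup>2 - \<beta>\<^sup>2 * (g u)\<^sup>2 < 0"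
    and "\<And>u. u \<in> J \<Longrightarrow> (deriv_on J f u)\<^sup>2 - (deriv_on J g u)\<^sup>2 > 0"
    and "\<not> contains_open_part_of_plane J {0..<2 * pi} (rot_surface \<alpha> \<beta> f g)"
  shows "minimal_surface J {0..<2 * pi} (rot_surface \<alpha> \<beta> f g) \<longleftrightarrow>
      (\<alpha> \<noteq> \<beta> \<and> (\<exists>c. \<exists>s\<in>{1, -1}. c \<noteq> 0 \<and>
          (\<forall>u\<in>J. f u = c * \<bar>g u\<bar> powr (s * (\<alpha> / \<beta>)))))
    \<or> (\<alpha> \<noteq> \<beta> \<and> (\<exists>A C. \<exists>s\<in>{1, -1}. A > 0 \<and>
          (\<exists>\<theta>. arcsin_branch_on J (\<lambda>u. \<beta> * g u / sqrt A) \<theta> \<and>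
             (\<forall>u\<in>J. \<bar>\<alpha> * f u / sqrt A\<bar> \<le> 1 \<and>
                arcsin (\<alpha> * f u / sqrt A) = s * (\<alpha> / \<beta>) * \<theta> u + C))))
    \<or> (\<alpha> = \<beta> \<and> (\<exists>a b. a \<noteq> 0 \<and>
          (\<forall>u\<in>J. (f u + g u)\<^sup>2 = a * (f u - g u)\<^sup>2 + b)))"
    (is "?minimal \<longleftrightarrow> (\<alpha> \<noteq> \<beta> \<and> ?power) \<or> (\<alpha> \<noteq> \<beta> \<and> ?arcsin) \<or> (\<alpha> = \<beta> \<and> ?quadratic)")
proof -
  obtain F where F: "F 0 = f"
      "\<And>k u. u \<in> J \<Longrightarrow> (F k has_real_derivative F (Suc k) u) (at u within J)"
    using assms(5) unfolding smooth_fun_on_def by auto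
  obtain G where G: "G 0 = g"
      "\<And>k u. u \<in> J \<Longrightarrow> (G k has_real_derivative G (Suc k) u) (at u within J)"
    using assms(6) unfolding smooth_fun_on_def by auto
  have deriv_on: "deriv_on J h u = h'"
    if "u \<in> J" "(h has_real_derivative h') (at u within J)" for h h' u
    unfolding deriv_on_def
    using that at_within_interval_neq_bot[OF assms(1,2)]
    by (intro vector_derivative_within) (simp_all add: has_real_derivative_iff_has_vector_derivative)
  interpret lorentz_meridian \<alpha> \<beta> J f g "F 1" "G 1" "F 2" "G 2"
  proof
    fix u assume u: "u \<in> J"
    show f: "(f has_real_derivative F 1 u) (at u within J)"
      and g: "(g has_real_derivative G 1 u) (at u within J)"
      using F(2)[OF u, of 0] G(2)[OF u, of 0] by (simp_all add: F(1) G(1))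
    show "(F 1 has_real_derivative F 2 u) (at u within J)"
      "(G 1 has_real_derivative G 2 u) (at u within J)"
      using F(2)[OF u, of 1] G(2)[OF u, of 1] by (simp_all add: numeral_2_eq_2)
    show "(F 1 u)\<^sup>2 - (G 1 u)\<^sup>2 > 0"
      using assms(8)[OF u] by (simp add: deriv_on[OF u f] deriv_on[OF u g])
  qed (use assms in auto)
  show ?thesis
  proof
    assume ?minimal
    then obtain A \<delta> where A: "A > 0"
      and rel: "\<And>u. u \<in> J \<Longrightarrow> \<beta> * g u = sqrt A * sin (phase A u + \<delta>)"
      using minimal_imp_sine_relation minimal_surface_iff by metis
    have ?arcsin
      using A sine_relation_imp_arcsin_relation[OF A rel] by blast
    moreover have ?quadratic if "\<alpha> = \<beta>"
      using sine_relation_imp_quadratic_relation[OF that A rel] .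
    ultimately show "(\<alpha> \<noteq> \<beta> \<and> ?power) \<or> (\<alpha> \<noteq> \<beta> \<and> ?arcsin) \<or> (\<alpha> = \<beta> \<and> ?quadratic)"
      by blast
  next
    assume "(\<alpha> \<noteq> \<beta> \<and> ?power) \<or> (\<alpha> \<noteq> \<beta> \<and> ?arcsin) \<or> (\<alpha> = \<beta> \<and> ?quadratic)"
    then consider ?power | ?arcsin | "\<alpha> = \<beta>" ?quadratic by blast
    then have "minimal_eq u" if u: "u \<in> J" for u
    proof cases
      case 1
      then obtain c s where s: "s \<in> {1, -1}"
        and rel: "\<And>u. u \<in> J \<Longrightarrow> f u = c * \<bar>g u\<bar> powr (s * (\<alpha> / \<beta>))" by blast
      have "\<bar>s * (\<alpha> / \<beta>)\<bar> = \<alpha> / \<beta>" using s pos by (auto simp: abs_mult)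
      then show ?thesis using not_power_relation rel by blast
    next
      case 2
      then obtain A C s \<theta> where "A > 0" "s \<in> {1, -1}"
        and "arcsin_branch_on J (\<lambda>u. \<beta> * g u / sqrt A) \<theta>"
        and "\<And>u. u \<in> J \<Longrightarrow> arcsin (\<alpha> * f u / sqrt A) = s * (\<alpha> / \<beta>) * \<theta> u + C" by blast
      then show ?thesis
        using arcsin_relation_imp_sine_relation sine_relation_imp_minimal u by metis
    next
      case 3
      then show ?thesis using quadratic_relation_imp_minimal u by blast
    qed
    then show ?minimal by (simp add: minimal_surface_iff)
  qed
qed

end
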